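(* Define polynomials $F_s(r)$ by $F_0(r)=F_1(r)=1$ and $F_s(r)=(1+r+2r^2)F_{s-1}(r)+r^3F_{s-2}(r)$ for $s\geq 2$. Then for all integers $s\geq 1$, we have $$\mathrm{EN}_{s,3}(2143)(q)=q^{9\binom{s}{2}}F_s(1/q).$$
   Context: For integers $s,t\ge 1$, $\mathrm{EN}_{s,t}$ is the rectangular poset on the label set $\{1,\ldots,st\}$ whose labels are arranged in $s$ rows of length $t$, row $i$ (for $0\le i\le s-1$) being $it+1,it+2,\ldots,it+t$, and whose order is generated by the relations $it+j<_{\mathrm{EN}} it+j+1$ for $0\le i\le s-1$, $1\le j\le t-1$, and $(i+1)t+j<_{\mathrm{EN}} it+j$ for $0\le i\le s-2$, $1\le j\le t$. A linear extension of $\mathrm{EN}_{s,t}$ is viewed as a permutation $\pi=\pi_1\cdots\pi_{st}\in S_{st}$ of the labels in which $a$ appears before $b$ whenever $a<_{\mathrm{EN}}b$. For example, the linear extensions of $\mathrm{EN}_{3,2}$ are $531642,536142,536412,563142,563412$. A permutation $\sigma=\sigma_1\cdots\sigma_n$ contains the pattern $\tau=\tau_1\cdots\tau_m\in S_m$ if there are indices $i_1<\cdots<i_m$ such that for all $j,l\in\{1,\ldots,m\}$ one has $\sigma_{i_j}<\sigma_{i_l}$ if and only if $\tau_j<\tau_l$; otherwise $\sigma$ avoids $\tau$. $\mathrm{EN}_{s,t}(\tau)$ is the set of linear extensions of $\mathrm{EN}_{s,t}$ that avoid $\tau$. An inversion of $\pi$ is a pair $(i,j)$ with $i<j$ and $\pi_i>\pi_j$,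 and $\mathrm{inv}(\pi)$ is the number of inversions of $\pi$. Finally, $\mathrm{EN}_{s,t}(\tau)(q)=\sum_{\pi\in \mathrm{EN}_{s,t}(\tau)}q^{\mathrm{inv}(\pi)}$. *)

theory Defs
  imports
    "HOL-Computational_Algebra.Computational_Algebra"
    "HOL-Combinatorics.Multiset_Permutations"
begin

inductive EN_gen :: "nat \<Rightarrow> nat \<Rightarrow> nat \<Rightarrow> nat \<Rightarrow> bool" for s t :: nat where
  row: "i < s \<Longrightarrow> 1 \<le> j \<Longrightarrow> j < t \<Longrightarrow> EN_gen s t (i * t + j) (i * t + j + 1)"
| col: "i + 1 < s \<Longrightarrow> 1 \<le> j \<Longrightarrow> j \<le> t \<Longrightarrow> EN_gen s t ((i + 1) * t + j) (i * t + j)"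

definition EN_less :: "nat \<Rightarrow> nat \<Rightarrow> nat \<Rightarrow> nat \<Rightarrow> bool" where
  "EN_less s t = (EN_gen s t)\<^sup>+\<^sup>+"

text \<open>Permutations are words in one-line notation, i.e. lists of labels; list positions
  start at 0, while labels and pattern entries start at 1.\<close>

definition appears_before :: "'a list \<Rightarrow> 'a \<Rightarrow> 'a \<Rightarrow> bool" where
  "appears_before \<pi> a b \<longleftrightarrow> (\<exists>i j. i < j \<and> j < length \<pi> \<and> \<pi> ! i = a \<and> \<pi> ! j = b)"

definition EN_linear_extensions :: "nat \<Rightarrow> nat \<Rightarrow> nat list set" where
  "EN_linear_extensions s t =
     {\<pi> \<in> permutations_of_set {1..s * t}. \<forall>a b. EN_less s t a b \<longrightarrow> appears_before \<pi> a b}"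

definition contains_pattern :: "nat list \<Rightarrow> nat list \<Rightarrow> bool" where
  "contains_pattern \<sigma> \<tau> \<longleftrightarrow>
     (\<exists>f :: nat \<Rightarrow> nat. strict_mono_on {..<length \<tau>} f \<and> f ` {..<length \<tau>} \<subseteq> {..<length \<sigma>} \<and>
        (\<forall>j<length \<tau>. \<forall>l<length \<tau>. \<sigma> ! f j < \<sigma> ! f l \<longleftrightarrow> \<tau> ! j < \<tau> ! l))"

definition EN_avoid :: "nat \<Rightarrow> nat \<Rightarrow> nat list \<Rightarrow> nat list set" where
  "EN_avoid s t \<tau> = {\<pi> \<in> EN_linear_extensions s t. \<not> contains_pattern \<pi> \<tau>}"

definition inversion_number :: "nat list \<Rightarrow> nat" where
  "inversion_number \<pi> = card {(i, j). i < j \<and> j < length \<pi> \<and> \<pi> ! i > \<pi> ! j}"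

definition EN_avoid_poly :: "nat \<Rightarrow> nat \<Rightarrow> nat list \<Rightarrow> int poly" where
  "EN_avoid_poly s t \<tau> = (\<Sum>\<pi>\<in>EN_avoid s t \<tau>. monom 1 (inversion_number \<pi>))"

fun F :: "nat \<Rightarrow> int poly" where
  "F 0 = 1"
| "F (Suc 0) = 1"
| "F (Suc (Suc s)) = [:1, 1, 2:] * F (Suc s) + monom 1 3 * F s"

text \<open>The indeterminate of \<open>\<int>[q]\<close> as an element of its field of fractions \<open>\<rat>(q)\<close>, so that
  \<open>1/q\<close> makes sense.\<close>

definition indet :: "int poly fract" where
  "indet = to_fract (monom 1 1)"

end

theory Submission
  imports Defs
begin

text \<open>
  If a linear extension has a label of row \<open>i\<close> before a label of a row \<open>j \<ge> i + 2\<close>, then these are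
  the 1 and the 4 of an occurrence of 2143, the 2 and the 3 being supplied by row \<open>i + 1\<close>; conversely
  the 1 and the 4 of every occurrence of 2143 form such a pair. So avoidance says that only consecutive rows
  interleave. Deleting the labels 1, 2, 3 (and lowering the others by 3) therefore leaves an
  avoiding extension for \<open>s - 1\<close>, in which all of 4, 5, 6 that follow the last label above 6 can be
  shuffled with 1, 2, 3. There are three ways to reinsert 1, 2, 3 in general, losing 0, 1 or 2 of
  the \<open>9 * (s - 1)\<close> possible new inversions, and two more, losing 2 or 3, if the word ends in 5, 6.
  With \<open>r = 1 / q\<close>, \<open>T\<close> the normalised sum over all words and \<open>H\<close> that over the words ending in
  2, 3, this gives \<open>T' = (1 + r + r\<^sup>2) T + (r\<^sup>2 + r\<^sup>3) H\<close> and \<open>H' = (1 + r) T + r\<^sup>2 H\<close>, and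
  eliminating \<open>H\<close> yields the recurrence of \<open>F\<close>.
\<close>

text \<open>Rows are counted from 1 here: \<open>label_row\<close> of 1, 2, 3 is 1 (and the junk label 0 gets row 0).\<close>

definition label_row :: "nat \<Rightarrow> nat" where
  "label_row x = (x + 2) div 3"

text \<open>\<open>x\<close> may precede \<open>y\<close> in an avoiding linear extension. For labels in rows \<open>i\<close> and \<open>i + 1\<close>,
  \<open>x + 3 < y\<close> says that the column of \<open>y\<close> is strictly to the right of that of \<open>x\<close>.\<close>

definition admissible :: "nat \<Rightarrow> nat \<Rightarrow> bool" where
  "admissible x y \<longleftrightarrow> label_row x = label_row y \<and> x < y \<or> label_row y < label_row x \<or>
     label_row y = label_row x + 1 \<and> x + 3 < y"

definition admissible_words :: "nat \<Rightarrow> nat list set" where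
  "admissible_words s = {w. distinct w \<and> set w = {1..3 * s} \<and> sorted_wrt admissible w}"

section \<open>Arithmetic of rows\<close>

lemma label_row_bounds: "x \<le> 3 * label_row x" "3 * label_row x < x + 3"
  unfolding label_row_def by presburger+

lemma label_row_unique: "x \<le> 3 * r \<Longrightarrow> 3 * r < x + 3 \<Longrightarrow> label_row x = r"
  using label_row_bounds[of x] by linarith

lemma label_row_le_iff: "label_row x \<le> r \<longleftrightarrow> x \<le> 3 * r"
  using label_row_bounds[of x] by linarith

lemma label_row_mono: "x \<le> y \<Longrightarrow> label_row x \<le> label_row y"
  using label_row_bounds[of y] by (simp add: label_row_le_iff)

lemma label_row_entry: "1 \<le> j \<Longrightarrow> j \<le> 3 \<Longrightarrow> label_row (i * 3 + j) = i + 1"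
  by (intro label_row_unique) auto

lemma label_row_add3 [simp]: "label_row (x + 3) = label_row x + 1"
  by (simp add: label_row_def)

text \<open>Only row differences and comparisons of \<open>x\<close>, \<open>y\<close> enter
  \<open>admissible\<close>, so moving both labels by a whole row changes nothing. This makes the
  deletion of the first row recursive.\<close>

lemma admissible_add3 [simp]: "admissible (x + 3) (y + 3) \<longleftrightarrow> admissible x y"
  by (auto simp: admissible_def)

section \<open>Order relations derived from the generators\<close>

lemma EN_less_trans: "EN_less s t a b \<Longrightarrow> EN_less s t b c \<Longrightarrow> EN_less s t a c"
  unfolding EN_less_def by (rule tranclp_trans)

lemma label_entryE:
  assumes "1 \<le> a"
  obtains i j where "a = i * 3 + j" "1 \<le> j" "j \<le> (3::nat)"
proof
  show "a = (a - 1) div 3 * 3 + Suc ((a - 1) mod 3)"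
    using div_mult_mod_eq[of "a - 1" 3] assms by linarith
  show "Suc ((a - 1) mod 3) \<le> 3"
    by (simp add: Suc_le_eq)
qed simp

lemma EN_less_row_Suc:
  assumes "1 \<le> a" "a + 1 \<le> 3 * s" "label_row a = label_row (a + 1)"
  shows "EN_less s 3 a (a + 1)"
proof -
  obtain i j where a: "a = i * 3 + j" "1 \<le> j" "j \<le> 3"
    using assms(1) by (rule label_entryE)
  have "i < s"
    using a assms(2) by linarith
  \<comment> \<open>For \<open>j = 3\<close> the label \<open>a + 1\<close> would open the next
    row.\<close>
  moreover have "j < 3"
    using label_row_bounds[of "a + 1"] label_row_entry[OF a(2,3), of i] a assms(3)
    by (simp add: not_less)
  ultimately have "EN_gen s 3 a (a + 1)"
    using EN_gen.row[of i s j 3] a by simp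
  then show ?thesis by (auto simp: EN_less_def)
qed

lemma EN_less_row:
  assumes "1 \<le> a" "a < b" "b \<le> 3 * s" "label_row a = label_row b"
  shows "EN_less s 3 a b"
proof -
  \<comment> \<open>A row has three entries, so at most two generating steps separate
    \<open>a\<close> from \<open>b\<close>.\<close>
  have "b = a + 1 \<or> b = a + 1 + 1 \<and> label_row (a + 1) = label_row a"
    using assms label_row_mono[of a "a + 1"] label_row_mono[of "a + 1" b]
      label_row_bounds[of a] label_row_bounds[of b] by linarith
  then show ?thesis
  proof
    assume "b = a + 1"
    then show ?thesis using EN_less_row_Suc assms by blast
  next
    assume b: "b = a + 1 + 1 \<and> label_row (a + 1) = label_row a"
    then have "EN_less s 3 a (a + 1)" "EN_less s 3 (a + 1) b"
      using EN_less_row_Suc[of a s] EN_less_row_Suc[of "a + 1" s] assms by auto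
    then show ?thesis by (rule EN_less_trans)
  qed
qed

lemma EN_less_column_3:
  assumes "1 \<le> a" "a + 3 \<le> 3 * s"
  shows "EN_less s 3 (a + 3) a"
proof -
  obtain i j where a: "a = i * 3 + j" "1 \<le> j" "j \<le> 3"
    using assms(1) by (rule label_entryE)
  then have "EN_gen s 3 ((i + 1) * 3 + j) a"
    using EN_gen.col[of i s j 3] assms(2) by simp
  moreover have "(i + 1) * 3 + j = a + 3"
    using a by simp
  ultimately have "EN_gen s 3 (a + 3) a" by metis
  then show ?thesis unfolding EN_less_def by (rule tranclp.r_into_trancl)
qed

lemma EN_less_column:
  assumes "1 \<le> a" "a + 3 * Suc k \<le> 3 * s"
  shows "EN_less s 3 (a + 3 * Suc k) a"
  using assms(2)
proof (induction k)
  case 0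
  then show ?case using EN_less_column_3 assms(1) by simp
next
  case (Suc k)
  have "EN_less s 3 (a + 3 * Suc k + 3) (a + 3 * Suc k)"
    using Suc.prems by (intro EN_less_column_3) auto
  moreover have "EN_less s 3 (a + 3 * Suc k) a"
    using Suc by simp
  ultimately have "EN_less s 3 (a + 3 * Suc k + 3) a"
    by (rule EN_less_trans)
  then show ?case by (simp add: ac_simps)
qed

section \<open>Relative order of entries in a word\<close>

lemma appears_before_nth:
  assumes "distinct w" "i < length w" "j < length w"
  shows "appears_before w (w ! i) (w ! j) \<longleftrightarrow> i < j"
  unfolding appears_before_def using assms by (metis nth_eq_iff_index_eq order.strict_trans)

lemma appears_beforeE:
  assumes "appears_before w a b"
  obtains i j where "i < j" "j < length w" "a = w ! i" "b = w ! j"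
  using assms unfolding appears_before_def by blast

lemma appears_before_trans:
  assumes "distinct w" "appears_before w a b" "appears_before w b c"
  shows "appears_before w a c"
proof -
  obtain i j where ij: "i < j" "j < length w" "a = w ! i" "b = w ! j"
    using assms(2) by (rule appears_beforeE)
  obtain k l where kl: "k < l" "l < length w" "b = w ! k" "c = w ! l"
    using assms(3) by (rule appears_beforeE)
  have "j = k"
    using ij kl assms(1) by (simp add: nth_eq_iff_index_eq)
  then show ?thesis
    using ij kl assms(1) by (simp add: appears_before_nth)
qed

lemma appears_before_asym:
  assumes "distinct w" "appears_before w a b"
  shows "\<not> appears_before w b a"
proof -
  obtain i j where "i < j" "j < length w" "a = w ! i" "b = w ! j"
    using assms(2) by (rule appears_beforeE)
  then show ?thesis using assms(1) by (simp add: appears_before_nth)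
qed

lemma appears_before_linear:
  assumes "a \<in> set w" "b \<in> set w" "a \<noteq> b"
  shows "appears_before w a b \<or> appears_before w b a"
  using assms unfolding appears_before_def in_set_conv_nth by (auto, metis nat_neq_iff)

lemma sorted_wrt_appears_before:
  "sorted_wrt R w \<longleftrightarrow> (\<forall>a b. appears_before w a b \<longrightarrow> R a b)"
  unfolding appears_before_def sorted_wrt_iff_nth_less by blast

section \<open>Occurrences of 2143 in terms of values\<close>

lemma contains_2143:
  assumes "appears_before w b a" "appears_before w a d" "appears_before w d c"
    and "distinct w" "a < b" "b < c" "c < d"
  shows "contains_pattern w [2, 1, 4, 3]"
proof -
  obtain i0 i1 where 1: "i0 < i1" "i1 < length w" "b = w ! i0" "a = w ! i1"
    using assms(1) by (rule appears_beforeE)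
  have "d \<in> set w" "c \<in> set w"
    using assms(3) by (auto simp: appears_before_def)
  then obtain i2 i3 where 2: "i2 < length w" "d = w ! i2" "i3 < length w" "c = w ! i3"
    by (auto simp: in_set_conv_nth)
  have 3: "i1 < i2" "i2 < i3"
    using assms(2-4) 1 2 by (simp_all add: appears_before_nth)
  let ?f = "\<lambda>n. [i0, i1, i2, i3] ! n"
  have 4: "{..<length [2, 1, 4, 3 :: nat]} = {0, 1, 2, 3}" by auto
  have "strict_mono_on {..<length [2, 1, 4, 3 :: nat]} ?f"
    using 1 2 3 unfolding 4 by (auto simp: strict_mono_on_def)
  moreover have "?f ` {..<length [2, 1, 4, 3 :: nat]} \<subseteq> {..<length w}"
    using 1 2 3 unfolding 4 by auto
  moreover have "w ! ?f j < w ! ?f l \<longleftrightarrow> [2, 1, 4, 3 :: nat] ! j < [2, 1, 4, 3] ! l"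
    if "j \<in> {0, 1, 2, 3}" "l \<in> {0, 1, 2, 3}" for j l
    using that 1 2 3 assms(5-7) by auto
  ultimately show ?thesis
    unfolding contains_pattern_def using 4 by (intro exI[of _ ?f]) blast
qed

lemma contains_2143E:
  assumes "contains_pattern w [2, 1, 4, 3]"
  obtains a b c d where "appears_before w b a" "appears_before w a d" "appears_before w d c"
    "a < b" "b < c" "c < d"
proof -
  obtain f where f: "strict_mono_on {..<4::nat} f" "f ` {..<4} \<subseteq> {..<length w}"
    and *: "\<And>j l. j < 4 \<Longrightarrow> l < 4 \<Longrightarrow> w ! f j < w ! f l \<longleftrightarrow> [2, 1, 4, 3 :: nat] ! j < [2, 1, 4, 3] ! l"
    using assms unfolding contains_pattern_def by (auto simp: eval_nat_numeral)
  have "f 0 < f 1" "f 1 < f 2" "f 2 < f 3"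
    using f(1) by (auto simp: strict_mono_on_def)
  moreover have "f 1 < length w" "f 2 < length w" "f 3 < length w"
    using f(2) by (force simp: image_subset_iff)+
  moreover have "w ! f 1 < w ! f 0" "w ! f 0 < w ! f 3" "w ! f 3 < w ! f 2"
    using *[of 1 0] *[of 0 3] *[of 3 2] by auto
  ultimately show ?thesis
    using that[of "w ! f 0" "w ! f 1" "w ! f 2" "w ! f 3"] unfolding appears_before_def by blast
qed

section \<open>Avoiding linear extensions are the admissible words\<close>

text \<open>An inadmissible pair in word order either reverses a relation of the poset or, if its
  second label lies two or more rows further, completes to a 2143.\<close>

lemma EN_avoid_subset_admissible:
  assumes "w \<in> EN_avoid s 3 [2, 1, 4, 3]"
  shows "w \<in> admissible_words s"
proof -
  have w: "distinct w" "set w = {1..3 * s}"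
    and lin: "\<And>a b. EN_less s 3 a b \<Longrightarrow> appears_before w a b"
    and avoid: "\<not> contains_pattern w [2, 1, 4, 3]"
    using assms by (auto simp: EN_avoid_def EN_linear_extensions_def permutations_of_set_def mult.commute)
  have "admissible x y" if xy: "appears_before w x y" for x y
  proof (rule ccontr)
    assume bad: "\<not> admissible x y"
    have "x \<in> set w" "y \<in> set w"
      using xy by (auto simp: appears_before_def)
    then have x: "1 \<le> x" "x \<le> 3 * s" and y: "1 \<le> y" "y \<le> 3 * s"
      using w by auto
    have neq: "x \<noteq> y" and nlt: "\<not> EN_less s 3 y x"
      using appears_before_asym[OF w(1) xy] xy lin by auto
    consider "label_row x = label_row y" "y < x" | "label_row y = label_row x + 1" "y \<le> x + 3"
      | "label_row x + 2 \<le> label_row y"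
      using bad neq unfolding admissible_def by linarith
    then show False
    proof cases
      case 1
      then show False using EN_less_row[of y x s] x y nlt by simp
    next
      case 2
      have x3: "x + 3 \<le> 3 * s"
        using 2(1) y(2) by (simp flip: label_row_le_iff)
      then have "EN_less s 3 (x + 3) x"
        using EN_less_column[of x 0 s] x by simp
      \<comment> \<open>In the row of \<open>x + 3\<close> the label \<open>y\<close> lies weakly to
        the left, so it equals or precedes \<open>x + 3\<close> in the poset, and
        \<open>x + 3\<close> precedes \<open>x\<close>.\<close>
      moreover have "y = x + 3 \<or> EN_less s 3 y (x + 3)"
        using EN_less_row[of y "x + 3" s] 2 x3 y by force
      ultimately show False using nlt EN_less_trans by blast
    next
      case 3
      text \<open>\<open>x\<close> and \<open>y\<close> are the 1 and the 4 of the pattern; the 2 and the 3 are the labels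
        of the row next to \<open>x\<close> in the columns of \<open>x\<close> and \<open>y\<close>.\<close>
      define k where "k = label_row y - label_row x - 2"
      define c where "c = y - 3 * Suc k"
      have k: "label_row y = label_row x + 2 + k"
        using 3 by (simp add: k_def)
      have c: "y = c + 3 * Suc k" "1 \<le> c"
        using k x label_row_bounds[of x] label_row_bounds[of y] unfolding c_def by auto
      have x3: "x + 3 \<le> 3 * s"
        using k y(2) by (simp flip: label_row_le_iff)
      have row_c: "label_row c = label_row (x + 3)"
        using c k label_row_bounds[of y] by (intro label_row_unique) auto
      have bx: "appears_before w (x + 3) x"
        using EN_less_column[of x 0 s] x x3 lin by simp
      have yc: "appears_before w y c"
        using EN_less_column[of c k s] c y lin by simp
      have bc: "appears_before w (x + 3) c"
        using bx xy yc appears_before_trans[OF w(1)] by blast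
      \<comment> \<open>The word contains \<open>x + 3\<close>, \<open>x\<close>, \<open>y\<close>,
        \<open>c\<close> in this order. As \<open>c\<close> shares the row of \<open>x + 3\<close>
        and comes later, it must be the larger one, which gives the values of a 2143.\<close>
      have "\<not> c \<le> x + 3"
        using EN_less_row[of c "x + 3" s] c row_c x3 lin appears_before_asym[OF w(1) bc] bc
        by (cases "c = x + 3") auto
      then show False
        using contains_2143[OF bx xy yc w(1)] avoid c(1) by simp
    qed
  qed
  then show ?thesis
    using w by (simp add: admissible_words_def sorted_wrt_appears_before)
qed

text \<open>For each generating relation the reversed pair is inadmissible, so the word must have
  the two labels in the right order; transitivity extends this to the whole poset.\<close>

lemma admissible_subset_EN_avoid:
  assumes "w \<in> admissible_words s"
  shows "w \<in> EN_avoid s 3 [2, 1, 4, 3]"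
proof -
  have w: "distinct w" "set w = {1..3 * s}"
    and adm: "\<And>a b. appears_before w a b \<Longrightarrow> admissible a b"
    using assms by (auto simp: admissible_words_def sorted_wrt_appears_before)
  have gen: "appears_before w a b" if "EN_gen s 3 a b" for a b
  proof -
    have "a \<in> set w \<and> b \<in> set w \<and> \<not> admissible b a \<and> a \<noteq> b"
      using that
    proof cases
      case (row i j)
      then show ?thesis
        using label_row_entry[of j i] label_row_entry[of "j + 1" i] by (simp add: admissible_def w(2))
    next
      case (col i j)
      then show ?thesis
        using label_row_entry[of j i] label_row_entry[of j "i + 1"] by (simp add: admissible_def w(2))
    qed
    then show ?thesis using appears_before_linear[of a w b] adm[of b a] by blast
  qed
  have "appears_before w a b" if "EN_less s 3 a b" for a b
    using that unfolding EN_less_def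
  proof (induction rule: tranclp_induct)
    case (base b)
    then show ?case by (rule gen)
  next
    case (step b c)
    then show ?case using appears_before_trans[OF w(1)] gen by blast
  qed
  moreover have "\<not> contains_pattern w [2, 1, 4, 3]"
  proof
    assume "contains_pattern w [2, 1, 4, 3]"
    then obtain a b c d where "appears_before w b a" "appears_before w a d" "appears_before w d c"
      and "a < b" "b < c" "c < d"
      by (rule contains_2143E)
    moreover from this have "admissible b a" "admissible a d" "admissible d c"
      using adm by simp_all
    \<comment> \<open>Both descents \<open>b a\<close> and \<open>d c\<close> force a strict drop of
      the row, so the row of \<open>d\<close> exceeds that of \<open>a\<close> by at least 2,
      against \<open>admissible a d\<close>.\<close>
    ultimately show False
      using label_row_mono[of a b] label_row_mono[of b c] label_row_mono[of c d]
      unfolding admissible_def by linarith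
  qed
  ultimately show ?thesis
    using w by (auto simp: EN_avoid_def EN_linear_extensions_def permutations_of_set_def mult.commute)
qed

lemma EN_avoid_eq_admissible_words: "EN_avoid s 3 [2, 1, 4, 3] = admissible_words s"
  using EN_avoid_subset_admissible admissible_subset_EN_avoid by blast

section \<open>Removing and restoring the first row\<close>

lemma length_admissible_word:
  assumes "w \<in> admissible_words s"
  shows "length w = 3 * s"
  using assms distinct_card[of w] by (auto simp: admissible_words_def)

text \<open>The labels 5 and 6 of an inserted block are the shifted 2 and 3, so their admissibility
  is inherited from the smaller word.\<close>

lemma admissible_add3_numerals:
  "admissible (x + 3) 6 \<longleftrightarrow> admissible x 3" "admissible (x + 3) 5 \<longleftrightarrow> admissible x 2"
  using admissible_add3[of x 3] admissible_add3[of x 2] by simp_all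

lemma admissible_first_row:
  assumes "1 \<le> x" "y \<le> 3"
  shows "admissible (x + 3) y"
proof -
  have "label_row y \<le> 1" "\<not> label_row x \<le> 0"
    using assms unfolding label_row_le_iff by simp_all
  then show ?thesis by (simp add: admissible_def)
qed

text \<open>3 stands in the last column, so no label of row 2 lies strictly to its right. The bound
  on \<open>y\<close> excludes the label 0, whose junk row 0 would be allowed after 3.\<close>

lemma not_admissible_3: "1 \<le> y \<Longrightarrow> \<not> admissible 3 y"
  using label_row_le_iff[of y 0] label_row_bounds[of y]
  by (auto simp: admissible_def label_row_def[of 3])

lemma admissible_word_ends_3:
  assumes "w \<in> admissible_words s" "s \<ge> 1"
  obtains p where "w = p @ [3]"
proof -
  have w: "set w = {1..3 * s}" "sorted_wrt admissible w"
    using assms by (auto simp: admissible_words_def)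
  have "3 \<in> set w" using w assms(2) by simp
  then obtain p v where pv: "w = p @ 3 # v" by (auto simp: in_set_conv_decomp)
  have "y \<ge> 1 \<and> admissible 3 y" if "y \<in> set v" for y
  proof
    have "y \<in> set w" using that pv by simp
    then show "y \<ge> 1" using w(1) by simp
  qed (use that w(2) pv in \<open>simp add: sorted_wrt_append\<close>)
  then have "set v = {}" using not_admissible_3 by (metis all_not_in_conv)
  then show ?thesis using that pv by simp
qed

abbreviation shift :: "nat list \<Rightarrow> nat list" where
  "shift \<equiv> map (\<lambda>x. x + 3)"

lemma inj_add3: "inj_on (\<lambda>x::nat. x + 3) A"
  by simp

lemma image_add3: "(\<lambda>x. x + 3) ` {1..n::nat} = {4..n + 3}"
  using image_add_atLeastAtMost'[of 3 1 n] by simp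

lemma admissible_words_delete_first_row:
  assumes "w \<in> admissible_words (Suc s)" "filter (\<lambda>x. x > 3) w = shift v"
  shows "v \<in> admissible_words s"
proof -
  have w: "distinct w" "set w = {1..3 * Suc s}" "sorted_wrt admissible w"
    using assms(1) by (auto simp: admissible_words_def)
  have "distinct (shift v)"
    unfolding assms(2)[symmetric] using w(1) by (rule distinct_filter)
  then have "distinct v"
    unfolding distinct_map by (rule conjunct1)
  moreover have "sorted_wrt admissible (shift v)"
    unfolding assms(2)[symmetric] using w(3) by (rule sorted_wrt_filter)
  then have "sorted_wrt admissible v"
    unfolding sorted_wrt_map admissible_add3 .
  moreover have "set v = {1..3 * s}"
  proof -
    have "(\<lambda>x. x + 3) ` set v = set (filter (\<lambda>x. x > 3) w)"
      unfolding assms(2) set_map ..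
    also have "\<dots> = {4..3 * s + 3}"
      unfolding set_filter w(2) by auto
    finally have "(\<lambda>x. x + 3) ` set v = (\<lambda>x. x + 3) ` {1..3 * s}"
      unfolding image_add3 .
    then show ?thesis
      unfolding inj_image_eq_iff[OF inj_add3] .
  qed
  ultimately show ?thesis
    by (simp add: admissible_words_def)
qed

text \<open>Giving the content of \<open>w\<close> as a multiset covers every way of shuffling in
  the first row at once.\<close>

lemma admissible_words_insert_first_row:
  assumes "v \<in> admissible_words s" "sorted_wrt admissible w"
    and "mset w = mset (shift v @ [1, 2, 3])"
  shows "w \<in> admissible_words (Suc s)"
proof -
  have v: "distinct v" "set v = {1..3 * s}"
    using assms(1) by (auto simp: admissible_words_def)
  have "set w = (\<lambda>x. x + 3) ` {1..3 * s} \<union> {1, 2, 3}"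
    using mset_eq_setD[OF assms(3)] v(2) by simp
  also have "\<dots> = {1..3 * Suc s}"
    unfolding image_add3 by auto
  finally have "set w = {1..3 * Suc s}" .
  moreover have "distinct (shift v @ [1, 2, 3])"
    using v(1) unfolding distinct_append distinct_map set_map v(2) image_add3 by auto
  then have "distinct w"
    using mset_eq_imp_distinct_iff[OF assms(3)] by blast
  ultimately show ?thesis
    using assms(2) by (simp add: admissible_words_def)
qed

section \<open>Recursive description of the admissible words\<close>

text \<open>The final 3 is forced for \<open>s \<ge> 1\<close>. With it dropped, the new block
  starts where the shifted 3, that is 6, would stand.\<close>

definition stems :: "nat \<Rightarrow> nat list set" where
  "stems s = {p. p @ [3] \<in> admissible_words s}"

text \<open>The words summed by \<open>H\<close>, stripped of their ending 2, 3.\<close>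

definition short_stems :: "nat \<Rightarrow> nat list set" where
  "short_stems s = {n. n @ [2] \<in> stems s}"

text \<open>\<open>v\<close> will be what follows 1 in a stem. Neither 2 nor 6 may precede 5, so 5
  comes first if it occurs, and then 6 occurs as well.\<close>

lemma first_row_shuffles:
  assumes "distinct v" "sorted_wrt admissible v" "set v \<subseteq> {2, 5, 6}" "2 \<in> set v"
    and "5 \<in> set v \<longrightarrow> 6 \<in> set v"
  shows "v \<in> {[2], [6, 2], [2, 6], [5, 6, 2], [5, 2, 6]}"
proof -
  have "length v = card (set v)" using assms(1) by (simp add: distinct_card)
  also have "\<dots> \<le> card {2, 5, 6 :: nat}" using assms(3) by (intro card_mono) auto
  finally have "length v \<le> 3" by simp
  then consider "length v = 0" | "length v = Suc 0" | "length v = Suc (Suc 0)"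
    | "length v = Suc (Suc (Suc 0))"
    by linarith
  then consider "v = []" | a where "v = [a]" | a b where "v = [a, b]" | a b c where "v = [a, b, c]"
    by cases (auto simp: length_Suc_conv)
  moreover have "\<not> admissible 2 5" "\<not> admissible 6 5"
    by (simp_all add: admissible_def label_row_def)
  ultimately show ?thesis
    by cases (use assms in auto)
qed

text \<open>The stem is cut at 1. The other first-row labels come later, and of the higher labels
  only 5 and 6 may follow 1, since 4 shares its column. Which of them do so decides how much of the
  ending of the reduced word is moved into the block.\<close>

lemma stems_Suc_cases:
  assumes "w \<in> stems (Suc s)" "s \<ge> 1"
  obtains p where "p \<in> stems s" "w \<in> {shift p @ [6, 1, 2], shift p @ [1, 6, 2], shift p @ [1, 2, 6]}"
  | n where "n \<in> short_stems s" "w \<in> {shift n @ [1, 5, 6, 2], shift n @ [1, 5, 2, 6]}"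
proof -
  have w: "w @ [3] \<in> admissible_words (Suc s)" using assms(1) by (simp add: stems_def)
  then have set_w: "set (w @ [3]) = {1..3 * Suc s}" and "distinct (w @ [3])"
    and "sorted_wrt admissible (w @ [3])"
    by (auto simp: admissible_words_def)
  have "1 \<in> set (w @ [3])" "2 \<in> set (w @ [3])" "6 \<in> set (w @ [3])"
    unfolding set_w using assms(2) by auto
  then have mem: "1 \<in> set w" "2 \<in> set w" "6 \<in> set w" by auto
  then obtain u v where uv: "w = u @ 1 # v" by (auto simp: in_set_conv_decomp)
  have dist: "distinct u" "distinct v" "3 \<notin> set u" "3 \<notin> set v" "1 \<notin> set u" "1 \<notin> set v"
    using \<open>distinct (w @ [3])\<close> uv by auto
  have sorted: "sorted_wrt admissible v" "\<And>x. x \<in> set u \<Longrightarrow> admissible x 1"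
    "\<And>y. y \<in> set v \<Longrightarrow> admissible 1 y" "\<And>x y. x \<in> set u \<Longrightarrow> y \<in> set v \<Longrightarrow> admissible x y"
    using \<open>sorted_wrt admissible (w @ [3])\<close> uv by (auto simp: sorted_wrt_append)
  have not_adm: "\<not> admissible 2 1" "\<not> admissible 6 5"
    by (simp_all add: admissible_def label_row_def)
  then have two: "2 \<notin> set u"
    using sorted(2)[of 2] by blast
  have "set v \<subseteq> {2, 5, 6}"
  proof
    fix y assume y: "y \<in> set v"
    then have "y \<in> set (w @ [3])" using uv by simp
    then have "y \<ge> 1" unfolding set_w by simp
    then have "\<not> label_row y \<le> 0" unfolding label_row_le_iff by simp
    then have "label_row y = 1 \<or> label_row y = 2 \<and> 4 < y"
      using sorted(3)[OF y] label_row_entry[of 1 0] by (auto simp: admissible_def)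
    then have "y \<in> {1, 2, 3, 5, 6}"
      using label_row_bounds[of y] \<open>y \<ge> 1\<close> by (elim disjE) force+
    then show "y \<in> {2, 5, 6}" using y dist by auto
  qed
  moreover have "2 \<in> set v" using mem(2) two uv by auto
  moreover have "5 \<in> set v \<longrightarrow> 6 \<in> set v"
    using sorted(4)[of 6 5] mem(3) not_adm uv by auto
  ultimately have v: "v \<in> {[2], [6, 2], [2, 6], [5, 6, 2], [5, 2, 6]}"
    using dist(2) sorted(1) by (intro first_row_shuffles)
  have u: "x > 3" if "x \<in> set u" for x
  proof -
    have "x \<in> set (w @ [3])" using that uv by simp
    then have "x \<ge> 1" unfolding set_w by simp
    moreover have "x \<notin> {1, 2, 3}" using that dist two by auto
    ultimately show ?thesis by auto
  qed
  \<comment> \<open>The truncated subtraction loses nothing, as all entries of \<open>u\<close>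
    exceed 3.\<close>
  define u' where "u' = map (\<lambda>x. x - 3) u"
  have u': "u = shift u'"
  proof -
    have "map (\<lambda>x. x - 3 + 3) u = u"
      by (rule map_idI) (use u in force)
    then show ?thesis by (simp add: u'_def o_def)
  qed
  have del: "x \<in> admissible_words s"
    if "u @ filter (\<lambda>x. x > 3) v = shift x" for x
    using that u by (intro admissible_words_delete_first_row[OF w]) (simp add: uv)
  consider "v = [2]" | "v \<in> {[6, 2], [2, 6]}" | "v \<in> {[5, 6, 2], [5, 2, 6]}"
    using v by blast
  then show ?thesis
  proof cases
    case 1
    \<comment> \<open>Here \<open>u'\<close> is the complete reduced word. Its final 3 becomes the 6
      of the block \<open>[6, 1, 2]\<close>.\<close>
    then have "u' \<in> admissible_words s" using u' by (intro del) simp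
    moreover from this assms(2) obtain p where "u' = p @ [3]"
      by (rule admissible_word_ends_3)
    ultimately show ?thesis using that(1)[of p] u' uv 1 by (simp add: stems_def)
  next
    case 2
    then have "u' @ [3] \<in> admissible_words s" using u' by (intro del) auto
    then show ?thesis using that(1)[of u'] u' uv 2 by (auto simp: stems_def)
  next
    case 3
    then have "u' @ [2, 3] \<in> admissible_words s" using u' by (intro del) auto
    then show ?thesis using that(2)[of u'] u' uv 3 by (auto simp: stems_def short_stems_def)
  qed
qed

lemma stems_SucI:
  assumes "p \<in> stems s" "w \<in> {[6, 1, 2], [1, 6, 2], [1, 2, 6]}"
  shows "shift p @ w \<in> stems (Suc s)"
proof -
  have p: "p @ [3] \<in> admissible_words s" using assms by (simp add: stems_def)
  then have "sorted_wrt admissible (p @ [3])" and *: "set (p @ [3]) = {1..3 * s}"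
    by (auto simp: admissible_words_def)
  moreover have "1 \<le> x" if "x \<in> set p" for x
    using that * by auto
  ultimately have "sorted_wrt admissible (shift p @ w @ [3])"
    using assms(2) admissible_first_row
    by (auto simp: sorted_wrt_append sorted_wrt_map admissible_add3_numerals)
      (simp_all add: admissible_def label_row_def)
  then have "shift p @ w @ [3] \<in> admissible_words (Suc s)"
    using assms(2) by (intro admissible_words_insert_first_row[OF p]) auto
  then show ?thesis by (simp add: stems_def)
qed

lemma stems_SucI_short:
  assumes "n \<in> short_stems s" "w \<in> {[1, 5, 6, 2], [1, 5, 2, 6]}"
  shows "shift n @ w \<in> stems (Suc s)"
proof -
  have n: "n @ [2, 3] \<in> admissible_words s" using assms by (simp add: short_stems_def stems_def)
  then have "sorted_wrt admissible (n @ [2, 3])" and *: "set (n @ [2, 3]) = {1..3 * s}"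
    by (auto simp: admissible_words_def)
  moreover have "1 \<le> x" if "x \<in> set n" for x
    using that * by auto
  ultimately have "sorted_wrt admissible (shift n @ w @ [3])"
    using assms(2) admissible_first_row
    by (auto simp: sorted_wrt_append sorted_wrt_map admissible_add3_numerals)
      (simp_all add: admissible_def label_row_def)
  then have "shift n @ w @ [3] \<in> admissible_words (Suc s)"
    using assms(2) by (intro admissible_words_insert_first_row[OF n]) auto
  then show ?thesis by (simp add: stems_def)
qed

lemma stems_Suc:
  assumes "s \<ge> 1"
  shows "stems (Suc s) =
    (\<lambda>p. shift p @ [6, 1, 2]) ` stems s \<union> (\<lambda>p. shift p @ [1, 6, 2]) ` stems s \<union>
    (\<lambda>p. shift p @ [1, 2, 6]) ` stems s \<union> (\<lambda>n. shift n @ [1, 5, 6, 2]) ` short_stems s \<union>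
    (\<lambda>n. shift n @ [1, 5, 2, 6]) ` short_stems s" (is "_ = ?R")
proof
  show "stems (Suc s) \<subseteq> ?R"
  proof
    fix w assume "w \<in> stems (Suc s)"
    then show "w \<in> ?R" by (rule stems_Suc_cases[OF _ assms]) blast+
  qed
  show "?R \<subseteq> stems (Suc s)"
    using stems_SucI stems_SucI_short by auto
qed

lemma snoc_eq_append_iff:
  "n @ [a] = xs @ [b, c, d] \<longleftrightarrow> n = xs @ [b, c] \<and> a = d"
  "n @ [a] = xs @ [b, c, d, e] \<longleftrightarrow> n = xs @ [b, c, d] \<and> a = e"
  using append1_eq_conv[of n a "xs @ [b, c]" d] append1_eq_conv[of n a "xs @ [b, c, d]" e]
  by (simp_all del: append1_eq_conv)

text \<open>Of the five blocks only the three that end in 2 contribute; that 2 is stripped.\<close>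

lemma short_stems_Suc:
  assumes "s \<ge> 1"
  shows "short_stems (Suc s) =
    (\<lambda>p. shift p @ [6, 1]) ` stems s \<union> (\<lambda>p. shift p @ [1, 6]) ` stems s \<union>
    (\<lambda>n. shift n @ [1, 5, 6]) ` short_stems s"
  unfolding short_stems_def[of "Suc s"] stems_Suc[OF assms] set_eq_iff mem_Collect_eq Un_iff image_iff
    snoc_eq_append_iff
  by simp

section \<open>The case of a single row\<close>

lemma admissible_words_1: "admissible_words 1 = {[1, 2, 3]}"
proof
  show "{[1, 2, 3]} \<subseteq> admissible_words 1"
    by (auto simp: admissible_words_def admissible_def label_row_def)
  show "admissible_words 1 \<subseteq> {[1, 2, 3]}"
  proof
    fix w assume w: "w \<in> admissible_words 1"
    have "length w = Suc (Suc (Suc 0))"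
      using length_admissible_word[OF w] by simp
    then obtain a b c where abc: "w = [a, b, c]"
      by (auto simp: length_Suc_conv)
    have *: "set w = {1..3}" "distinct w" "sorted_wrt admissible w"
      using w by (auto simp: admissible_words_def)
    have "{1..3} = {1, 2, 3 :: nat}"
      by auto
    then have "a \<in> {1, 2, 3}" "b \<in> {1, 2, 3}" "c \<in> {1, 2, 3}"
      using *(1) abc by auto
    moreover have "a \<noteq> b" "a \<noteq> c" "b \<noteq> c" "admissible a b" "admissible b c"
      using *(2,3) abc by simp_all
    moreover have "\<not> admissible 2 1" "\<not> admissible 3 1" "\<not> admissible 3 2"
      by (simp_all add: admissible_def label_row_def)
    ultimately show "w \<in> {[1, 2, 3]}"
      unfolding abc insert_iff empty_iff by (elim disjE) simp_all
  qed
qed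

lemma stems_1: "stems 1 = {[1, 2]}"
  unfolding stems_def admissible_words_1
  using snoc_eq_append_iff(1)[where xs = "[]" and b = 1 and c = 2 and d = 3 and a = 3]
  by (simp del: append1_eq_conv)

lemma short_stems_1: "short_stems 1 = {[1]}"
proof -
  have "n @ [2] = [1, 2] \<longleftrightarrow> n = [1]" for n :: "nat list"
    using append1_eq_conv[of n 2 "[1]" 2] by (simp del: append1_eq_conv)
  then show ?thesis
    unfolding short_stems_def stems_1 by (simp del: append1_eq_conv)
qed

section \<open>Inversion numbers\<close>

lemma inversion_number_Nil [simp]: "inversion_number [] = 0"
  by (simp add: inversion_number_def)

lemma inversion_number_snoc:
  "inversion_number (xs @ [y]) = inversion_number xs + length (filter (\<lambda>x. x > y) xs)"
proof -
  let ?A = "{(i, j). i < j \<and> j < length xs \<and> xs ! i > xs ! j}"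
  \<comment> \<open>\<open>?A\<close> holds the inversions inside \<open>xs\<close>,
    \<open>?B\<close> those that end at the new last position.\<close>
  let ?B = "(\<lambda>i. (i, length xs)) ` {i. i < length xs \<and> xs ! i > y}"
  have "{(i, j). i < j \<and> j < length (xs @ [y]) \<and> (xs @ [y]) ! i > (xs @ [y]) ! j} = ?A \<union> ?B"
    by (auto simp: nth_append less_Suc_eq)
  moreover have "?A \<subseteq> {..<length xs} \<times> {..<length xs}"
    by auto
  then have "finite ?A"
    by (rule finite_subset) simp
  moreover have "card ?B = length (filter (\<lambda>x. x > y) xs)"
    by (subst card_image) (auto simp: inj_on_def length_filter_conv_card)
  moreover have "?A \<inter> ?B = {}" by auto
  ultimately show ?thesis
    by (simp add: inversion_number_def card_Un_disjoint)
qed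

text \<open>Explicit tails are not literally of the form \<open>xs @ [y]\<close>, so each tail
  length up to five gets a rule that peels off its last entry.\<close>

lemma inversion_number_append2:
  "inversion_number (xs @ [y, z]) =
    inversion_number (xs @ [y]) + length (filter (\<lambda>x. x > z) (xs @ [y]))"
  using inversion_number_snoc[of "xs @ [y]" z] by simp

lemma inversion_number_append3:
  "inversion_number (xs @ [y, z, a]) =
    inversion_number (xs @ [y, z]) + length (filter (\<lambda>x. x > a) (xs @ [y, z]))"
  using inversion_number_snoc[of "xs @ [y, z]" a] by simp

lemma inversion_number_append4:
  "inversion_number (xs @ [y, z, a, b]) =
    inversion_number (xs @ [y, z, a]) + length (filter (\<lambda>x. x > b) (xs @ [y, z, a]))"
  using inversion_number_snoc[of "xs @ [y, z, a]" b] by simp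

lemma inversion_number_append5:
  "inversion_number (xs @ [y, z, a, b, c]) =
    inversion_number (xs @ [y, z, a, b]) + length (filter (\<lambda>x. x > c) (xs @ [y, z, a, b]))"
  using inversion_number_snoc[of "xs @ [y, z, a, b]" c] by simp

lemmas inversion_number_append_simps = inversion_number_append5 inversion_number_append4
  inversion_number_append3 inversion_number_append2 inversion_number_snoc

lemma inversion_number_shift: "inversion_number (shift xs) = inversion_number xs"
  by (induction xs rule: rev_induct) (simp_all add: inversion_number_snoc filter_map o_def)

text \<open>Shifted entries are at least 3: thresholds 1 and 2 count all of them, and the others
  drop by 3.\<close>

lemma length_filter_shift:
  "length (filter (\<lambda>x. x > 1) (shift p)) = length p" "length (filter (\<lambda>x. x > 2) (shift p)) = length p"
  "length (filter (\<lambda>x. x > 3) (shift p)) = length (filter (\<lambda>x. x > 0) p)"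
  "length (filter (\<lambda>x. x > 5) (shift p)) = length (filter (\<lambda>x. x > 2) p)"
  "length (filter (\<lambda>x. x > 6) (shift p)) = length (filter (\<lambda>x. x > 3) p)"
  by (induction p) auto

text \<open>Each of the \<open>3 * s\<close> old labels exceeds 1, 2 and 3, so at most
  \<open>9 * s\<close> inversions arise, less one for each old label behind a new one. The losses
  stand on the left to avoid truncated subtraction.\<close>

lemma inversion_number_stem:
  assumes "p \<in> stems s"
  shows "inversion_number (shift p @ [6, 1, 2, 3]) = inversion_number (p @ [3]) + 9 * s"
    "inversion_number (shift p @ [1, 6, 2, 3]) + 1 = inversion_number (p @ [3]) + 9 * s"
    "inversion_number (shift p @ [1, 2, 6, 3]) + 2 = inversion_number (p @ [3]) + 9 * s"
proof -
  have p: "p @ [3] \<in> admissible_words s"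
    using assms by (simp add: stems_def)
  have "3 * s = length p + 1"
    using length_admissible_word[OF p] by simp
  then have s: "9 * s = 3 * length p + 3"
    by linarith
  have set_p: "set (p @ [3]) = {1..3 * s}" using p by (auto simp: admissible_words_def)
  have pos: "length (filter (\<lambda>x. x > 0) p) = length p"
    proof (intro arg_cong[of _ _ length] filter_True ballI)
    fix x assume "x \<in> set p"
    then have "x \<in> {1..3 * s}" using set_p by auto
    then show "x > 0" by simp
  qed
  show "inversion_number (shift p @ [6, 1, 2, 3]) = inversion_number (p @ [3]) + 9 * s"
    "inversion_number (shift p @ [1, 6, 2, 3]) + 1 = inversion_number (p @ [3]) + 9 * s"
    "inversion_number (shift p @ [1, 2, 6, 3]) + 2 = inversion_number (p @ [3]) + 9 * s"
    unfolding s inversion_number_append_simps filter_append length_append length_filter_shift pos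
      inversion_number_shift by simp_all
qed

text \<open>The losses come from the pairs (1, 5) and (1, 6), and for the second block also from (2,
  6).\<close>

lemma inversion_number_short_stem:
  assumes "n \<in> short_stems s"
  shows "inversion_number (shift n @ [1, 5, 6, 2, 3]) + 2 = inversion_number (n @ [2, 3]) + 9 * s"
    "inversion_number (shift n @ [1, 5, 2, 6, 3]) + 3 = inversion_number (n @ [2, 3]) + 9 * s"
proof -
  have n: "n @ [2, 3] \<in> admissible_words s"
    using assms by (simp add: stems_def short_stems_def)
  have "3 * s = length n + 2"
    using length_admissible_word[OF n] by simp
  then have s: "9 * s = 3 * length n + 6"
    by linarith
  have set_n: "set (n @ [2, 3]) = {1..3 * s}" using n by (auto simp: admissible_words_def)
  have pos: "length (filter (\<lambda>x. x > 0) n) = length n"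
    proof (intro arg_cong[of _ _ length] filter_True ballI)
    fix x assume "x \<in> set n"
    then have "x \<in> {1..3 * s}" using set_n by auto
    then show "x > 0" by simp
  qed
  show "inversion_number (shift n @ [1, 5, 6, 2, 3]) + 2 = inversion_number (n @ [2, 3]) + 9 * s"
    "inversion_number (shift n @ [1, 5, 2, 6, 3]) + 3 = inversion_number (n @ [2, 3]) + 9 * s"
    unfolding s inversion_number_append_simps filter_append length_append length_filter_shift pos
      inversion_number_shift by simp_all
qed

section \<open>Recurrences for the generating sums\<close>

text \<open>\<open>T\<close> before normalisation, that is, with its factor
  \<open>q ^ (9 * (s choose 2))\<close>; \<open>short_stem_sum\<close> is \<open>H\<close> in the
  same sense.\<close>

definition stem_sum :: "'a :: field \<Rightarrow> nat \<Rightarrow> 'a" where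
  "stem_sum q s = (\<Sum>p\<in>stems s. q ^ inversion_number (p @ [3]))"

definition short_stem_sum :: "'a :: field \<Rightarrow> nat \<Rightarrow> 'a" where
  "short_stem_sum q s = (\<Sum>n\<in>short_stems s. q ^ inversion_number (n @ [2, 3]))"

lemma finite_admissible_words: "finite (admissible_words s)"
proof (rule finite_subset)
  show "admissible_words s \<subseteq> permutations_of_set {1..3 * s}"
    by (auto simp: admissible_words_def permutations_of_set_def)
qed (rule finite_permutations_of_set)

lemma finite_stems: "finite (stems s)"
  using finite_vimageI[OF finite_admissible_words, of "\<lambda>p. p @ [3]" s]
  by (simp add: stems_def vimage_def inj_def)

lemma finite_short_stems: "finite (short_stems s)"
  using finite_vimageI[OF finite_stems, of "\<lambda>p. p @ [2]" s]
  by (simp add: short_stems_def vimage_def inj_def)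

lemma inj_shift_append: "inj_on (\<lambda>p. shift p @ w) A"
  by (auto simp: inj_on_def inj_map_eq_map)

text \<open>Reversal turns the comparison of endings into one of list heads, which simplification
  decides for explicit blocks.\<close>

lemma shift_append_disjoint:
  assumes "\<And>xs ys :: nat list. rev w @ xs \<noteq> rev w' @ ys"
  shows "(\<lambda>p. shift p @ w) ` A \<inter> (\<lambda>p. shift p @ w') ` B = {}"
proof -
  have "shift p @ w \<noteq> shift p' @ w'" for p p'
    using assms[of "rev (shift p)" "rev (shift p')"] by (metis rev_append)
  then show ?thesis by blast
qed

text \<open>\<open>l\<close> is the number of possible new inversions, \<open>k\<close> the number
  lost, and \<open>z\<close> the ending stripped from the words.\<close>

lemma sum_image_shift_append:
  fixes q :: "'a :: field"
  assumes "q \<noteq> 0" "\<And>p. p \<in> A \<Longrightarrow> inversion_number (shift p @ w @ z) + k = g p + l"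
  shows "(\<Sum>v\<in>(\<lambda>p. shift p @ w) ` A. q ^ inversion_number (v @ z)) =
    q ^ l * (1 / q) ^ k * (\<Sum>p\<in>A. q ^ g p)"
proof -
  have "q ^ inversion_number (shift p @ w @ z) = q ^ l * (1 / q) ^ k * q ^ g p" if "p \<in> A" for p
  proof -
    have "q ^ inversion_number (shift p @ w @ z) * q ^ k = q ^ g p * q ^ l"
      using assms(2)[OF that] by (simp flip: power_add)
    then show ?thesis
      using assms(1) by (simp add: field_simps)
  qed
  then show ?thesis
    by (simp add: sum.reindex inj_shift_append sum_distrib_left)
qed

lemma stem_sum_Suc:
  fixes q :: "'a :: field"
  assumes "s \<ge> 1" "q \<noteq> 0"
  defines "r \<equiv> 1 / q"
  shows "stem_sum q (Suc s) =
    q ^ (9 * s) * ((1 + r + r ^ 2) * stem_sum q s + (r ^ 2 + r ^ 3) * short_stem_sum q s)"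
proof -
  let ?f = "\<lambda>w. q ^ inversion_number (w @ [3])"
  have "stem_sum q (Suc s) =
      sum ?f ((\<lambda>p. shift p @ [6, 1, 2]) ` stems s) +
      sum ?f ((\<lambda>p. shift p @ [1, 6, 2]) ` stems s) +
      sum ?f ((\<lambda>p. shift p @ [1, 2, 6]) ` stems s) +
      sum ?f ((\<lambda>n. shift n @ [1, 5, 6, 2]) ` short_stems s) +
      sum ?f ((\<lambda>n. shift n @ [1, 5, 2, 6]) ` short_stems s)"
    unfolding stem_sum_def stems_Suc[OF assms(1)]
    by (subst sum.union_disjoint;
        (simp add: finite_stems finite_short_stems Int_Un_distrib2 shift_append_disjoint)?)+
  also have "sum ?f ((\<lambda>p. shift p @ [6, 1, 2]) ` stems s) = q ^ (9 * s) * r ^ 0 * stem_sum q s"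
    unfolding stem_sum_def r_def
    by (rule sum_image_shift_append[OF assms(2)])
      (simp only: append.simps inversion_number_stem add_0_right)
  also have "sum ?f ((\<lambda>p. shift p @ [1, 6, 2]) ` stems s) = q ^ (9 * s) * r ^ 1 * stem_sum q s"
    unfolding stem_sum_def r_def
    by (rule sum_image_shift_append[OF assms(2)])
      (simp only: append.simps inversion_number_stem add_0_right)
  also have "sum ?f ((\<lambda>p. shift p @ [1, 2, 6]) ` stems s) = q ^ (9 * s) * r ^ 2 * stem_sum q s"
    unfolding stem_sum_def r_def
    by (rule sum_image_shift_append[OF assms(2)])
      (simp only: append.simps inversion_number_stem add_0_right)
  also have "sum ?f ((\<lambda>n. shift n @ [1, 5, 6, 2]) ` short_stems s) =
      q ^ (9 * s) * r ^ 2 * short_stem_sum q s"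
    unfolding short_stem_sum_def r_def
    by (rule sum_image_shift_append[OF assms(2)])
      (simp only: append.simps inversion_number_short_stem add_0_right)
  also have "sum ?f ((\<lambda>n. shift n @ [1, 5, 2, 6]) ` short_stems s) =
      q ^ (9 * s) * r ^ 3 * short_stem_sum q s"
    unfolding short_stem_sum_def r_def
    by (rule sum_image_shift_append[OF assms(2)])
      (simp only: append.simps inversion_number_short_stem add_0_right)
  finally show ?thesis
    by (simp add: algebra_simps)
qed

lemma short_stem_sum_Suc:
  fixes q :: "'a :: field"
  assumes "s \<ge> 1" "q \<noteq> 0"
  defines "r \<equiv> 1 / q"
  shows "short_stem_sum q (Suc s) =
    q ^ (9 * s) * ((1 + r) * stem_sum q s + r ^ 2 * short_stem_sum q s)"
proof -
  let ?f = "\<lambda>w. q ^ inversion_number (w @ [2, 3])"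
  have "short_stem_sum q (Suc s) =
      sum ?f ((\<lambda>p. shift p @ [6, 1]) ` stems s) +
      sum ?f ((\<lambda>p. shift p @ [1, 6]) ` stems s) +
      sum ?f ((\<lambda>n. shift n @ [1, 5, 6]) ` short_stems s)"
    unfolding short_stem_sum_def short_stems_Suc[OF assms(1)]
    by (subst sum.union_disjoint;
        (simp add: finite_stems finite_short_stems Int_Un_distrib2 shift_append_disjoint)?)+
  also have "sum ?f ((\<lambda>p. shift p @ [6, 1]) ` stems s) = q ^ (9 * s) * r ^ 0 * stem_sum q s"
    unfolding stem_sum_def r_def
    by (rule sum_image_shift_append[OF assms(2)])
      (simp only: append.simps inversion_number_stem add_0_right)
  also have "sum ?f ((\<lambda>p. shift p @ [1, 6]) ` stems s) = q ^ (9 * s) * r ^ 1 * stem_sum q s"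
    unfolding stem_sum_def r_def
    by (rule sum_image_shift_append[OF assms(2)])
      (simp only: append.simps inversion_number_stem add_0_right)
  also have "sum ?f ((\<lambda>n. shift n @ [1, 5, 6]) ` short_stems s) =
      q ^ (9 * s) * r ^ 2 * short_stem_sum q s"
    unfolding short_stem_sum_def r_def
    by (rule sum_image_shift_append[OF assms(2)])
      (simp only: append.simps inversion_number_short_stem add_0_right)
  finally show ?thesis
    by (simp add: algebra_simps)
qed

section \<open>Evaluating \<open>F\<close> and solving the recurrences\<close>

lemma poly_map_of_int_add:
  "poly (map_poly of_int (a + b)) x =
    poly (map_poly of_int a) x + poly (map_poly of_int b) (x :: 'a :: comm_ring_1)"
proof -
  have "map_poly of_int (a + b) = map_poly of_int a + (map_poly of_int b :: 'a poly)"
    by (rule poly_eqI) (simp add: coeff_map_poly)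
  then show ?thesis by simp
qed

lemma poly_map_of_int_mult:
  "poly (map_poly of_int (a * b)) x =
    poly (map_poly of_int a) x * poly (map_poly of_int b) (x :: 'a :: comm_ring_1)"
proof -
  have "map_poly of_int (a * b) = map_poly of_int a * (map_poly of_int b :: 'a poly)"
    by (rule poly_eqI) (simp add: coeff_map_poly coeff_mult)
  then show ?thesis by simp
qed

lemma poly_F_Suc_Suc:
  fixes x :: "'a :: comm_ring_1"
  shows "poly (map_poly of_int (F (Suc (Suc s)))) x =
    (1 + x + 2 * x ^ 2) * poly (map_poly of_int (F (Suc s))) x + x ^ 3 * poly (map_poly of_int (F s)) x"
proof -
  have "poly (map_poly of_int [:1, 1, 2:]) x = 1 + x + 2 * x ^ 2"
    by (simp add: map_poly_pCons algebra_simps power2_eq_square)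
  moreover have "poly (map_poly of_int (monom 1 3)) x = x ^ 3"
    by (simp add: map_poly_monom poly_monom)
  ultimately show ?thesis
    by (simp only: F.simps poly_map_of_int_add poly_map_of_int_mult)
qed

text \<open>The second conjunct is the value of \<open>H\<close> that the recurrence of \<open>T\<close> forces.\<close>

lemma stem_sum_closed_form:
  fixes q :: "'a :: field"
  assumes "s \<ge> 1" "q \<noteq> 0"
  defines "r \<equiv> 1 / q"
  defines "f \<equiv> \<lambda>s. poly (map_poly of_int (F s)) r"
  shows "stem_sum q s = q ^ (9 * (s choose 2)) * f s \<and>
    (r ^ 2 + r ^ 3) * short_stem_sum q s =
      q ^ (9 * (s choose 2)) * (f (Suc s) - (1 + r + r ^ 2) * f s)"
  using assms(1)
proof (induction s rule: dec_induct)
  case base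
  have "f 0 = 1" "f 1 = 1"
    by (simp_all add: f_def)
  \<comment> \<open>For \<open>s = 1\<close> this gives
    \<open>f 2 - (1 + r + r ^ 2) = r ^ 2 + r ^ 3\<close>, which matches the single short
    stem.\<close>
  moreover have "f (Suc 1) = (1 + r + 2 * r ^ 2) * f 1 + r ^ 3 * f 0"
    unfolding f_def by (simp only: One_nat_def poly_F_Suc_Suc)
  moreover have "inversion_number [1, 2, 3] = 0"
    using inversion_number_append_simps[of "[]"] by (simp add: inversion_number_snoc[of "[]", simplified])
  then have "stem_sum q 1 = 1" "short_stem_sum q 1 = 1"
    by (simp_all add: stem_sum_def short_stem_sum_def stems_1 short_stems_1 del: One_nat_def)
  ultimately show ?case
    by (simp add: binomial_eq_0 algebra_simps del: One_nat_def)
next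
  case (step s)
  define Q where "Q = q ^ (9 * (s choose 2))"
  \<comment> \<open>Pascal's rule: \<open>Suc s choose 2\<close> exceeds \<open>s choose 2\<close>
    by \<open>s\<close>, which absorbs the factor \<open>q ^ (9 * s)\<close> of both
    recurrences.\<close>
  have Q: "q ^ (9 * (Suc s choose 2)) = q ^ (9 * s) * Q"
    by (simp add: Q_def numeral_2_eq_2 algebra_simps flip: power_add)
  have f: "f (Suc (Suc s)) = (1 + r + 2 * r ^ 2) * f (Suc s) + r ^ 3 * f s"
    unfolding f_def by (rule poly_F_Suc_Suc)
  have IH: "stem_sum q s = Q * f s"
    "(r ^ 2 + r ^ 3) * short_stem_sum q s = Q * (f (Suc s) - (1 + r + r ^ 2) * f s)"
    using step.IH by (auto simp: Q_def)
  have "stem_sum q (Suc s) = q ^ (9 * s) * Q * f (Suc s)"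
    unfolding stem_sum_Suc[OF step.hyps(1) assms(2)] r_def[symmetric] IH
    by (simp add: algebra_simps)
  \<comment> \<open>The factor \<open>r ^ 2 + r ^ 3\<close> is carried along and never cancelled,
    since it vanishes at \<open>r = -1\<close>. After insertion of the induction hypothesis both
    sides equal \<open>q ^ (9 * s) * Q * (r ^ 2 * f (Suc s) + r ^ 3 * f s)\<close>.\<close>
  moreover have "(r ^ 2 + r ^ 3) * short_stem_sum q (Suc s) =
      q ^ (9 * s) * ((r ^ 2 + r ^ 3) * (1 + r) * stem_sum q s +
        r ^ 2 * ((r ^ 2 + r ^ 3) * short_stem_sum q s))"
    unfolding short_stem_sum_Suc[OF step.hyps(1) assms(2)] r_def[symmetric]
    by (simp add: algebra_simps)
  then have "(r ^ 2 + r ^ 3) * short_stem_sum q (Suc s) =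
      q ^ (9 * s) * Q * (f (Suc (Suc s)) - (1 + r + r ^ 2) * f (Suc s))"
    unfolding IH f by (simp add: algebra_simps power2_eq_square power3_eq_cube)
  ultimately show ?case
    by (simp add: Q)
qed

section \<open>Transfer to the field of fractions\<close>

lemma sum_admissible_words:
  assumes "s \<ge> 1"
  shows "(\<Sum>w\<in>admissible_words s. q ^ inversion_number w) = stem_sum q s"
proof -
  have "admissible_words s = (\<lambda>p. p @ [3]) ` stems s"
  proof
    show "admissible_words s \<subseteq> (\<lambda>p. p @ [3]) ` stems s"
    proof
      fix w assume w: "w \<in> admissible_words s"
      then obtain p where "w = p @ [3]"
        using assms by (rule admissible_word_ends_3)
      then show "w \<in> (\<lambda>p. p @ [3]) ` stems s"
        using w by (simp add: stems_def)
    qed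
  qed (auto simp: stems_def)
  then show ?thesis
    by (simp add: stem_sum_def sum.reindex inj_on_def)
qed

lemma to_fract_sum: "to_fract (sum f A) = (\<Sum>x\<in>A. to_fract (f x))"
  by (induction A rule: infinite_finite_induct) simp_all

lemma to_fract_monom: "to_fract (monom 1 n) = indet ^ n"
proof (induction n)
  case (Suc n)
  have "monom 1 (Suc n) = monom 1 1 * (monom 1 n :: int poly)"
    by (simp add: mult_monom)
  then have "to_fract (monom 1 (Suc n)) = indet * to_fract (monom 1 n)"
    by (simp only: to_fract_mult indet_def)
  then show ?case using Suc by simp
qed (simp flip: one_poly_eq_simps)

theorem theorem3p3:
  fixes s :: nat
  assumes "s \<ge> 1"
  shows "to_fract (EN_avoid_poly s 3 [2, 1, 4, 3]) =
           indet ^ (9 * (s choose 2)) * poly (map_poly of_int (F s)) (1 / indet)"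
proof -
  have "indet \<noteq> 0" by (simp add: indet_def)
  have "to_fract (EN_avoid_poly s 3 [2, 1, 4, 3]) = stem_sum indet s"
    unfolding EN_avoid_poly_def EN_avoid_eq_admissible_words to_fract_sum to_fract_monom
    by (rule sum_admissible_words[OF assms])
  then show ?thesis
    using stem_sum_closed_form[OF assms \<open>indet \<noteq> 0\<close>] by simp
qed

end
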